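(* Consider the $s$-stage explicit exponential Runge-Kutta (EERK) method $$U^{n,1}=u_h^{n-1},\qquad U^{n,i+1}=U^{n,1}+\sum_{j=1}^{i}a_{i+1,j}(-\tau L_\kappa)\left[\tau g_\kappa(U^{n,j})-\tau L_\kappa U^{n,1}\right]\ (1\le i\le s),\qquad u_h^n=U^{n,s+1},$$ with $L_\kappa=L_h+\kappa I$, $g_\kappa(u)=g_h(u)+\kappa u$, where $g_h$ is Lipschitz continuous with constant $\ell_g>0$ and $\kappa\ge 2\ell_g$. Let $D(z)=(d_{k\ell}(z))_{s\times s}$ be the associated differentiation matrix and $\mathcal{S}(D;z)=\frac12[D(z)+D(z)^T]$. If $\mathcal{S}(D;z)$ is positive (semi-)definite for all $z\le 0$, then the method preserves the energy dissipation law at all stages without any time-step constraint: for every $\tau>0$, every $n\ge1$ and every $1\le j\le s$, $$E[U^{n,j+1}]-E[U^{n,1}]\le-\frac1{\tau}\sum_{k=1}^{j}\Big\langle\delta_\tau U^{n,k+1},\sum_{\ell=1}^{k}d_{k\ell}(-\tau L_\kappa)\,\delta_\tau U^{n,\ell+1}\Big\rangle\le 0,$$ where $\delta_\tau U^{n,k+1}:=U^{n,k+1}-U^{n,k}$; in particular (taking $j=s$), for $n\ge 1$, $$E[u_h^n]-E[u_h^{n-1}]\le-\frac1{\tau}\sum_{k=1}^{s}\Big\langle\delta_\tau U^{n,k+1},\sum_{\ell=1}^{k}d_{k\ell}(-\tau L_\kappa)\,\delta_\tau U^{n,\ell+1}\Big\rangle.$$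
   Context: Setting: $M\ge1$, $\langle u,v\rangle=v^Tu$ and $\|v\|=\sqrt{\langle v,v\rangle}$ on $\mathbb{R}^M$. $L_h\in\mathbb{R}^{M\times M}$ is symmetric positive definite. $G_h\ge0$ is a non-negative Lyapunov function with $g_h(v)=-\frac{\delta}{\delta v}G_h(v)$, i.e. the gradient of the scalar function $v\mapsto\langle G_h(v),1\rangle$ is $-g_h(v)$, where $g_h:\mathbb{R}^M\to\mathbb{R}^M$ and $1$ is the all-ones vector. The energy is $E[v]=\frac12\langle v,L_hv\rangle+\langle G_h(v),1\rangle$, and the gradient flow is $u_h'=-L_hu_h+g_h(u_h)=-\frac{\delta E}{\delta u_h}$, along which $\frac{dE}{dt}=-\|u_h'\|^2\le0$ (the energy dissipation law). Lipschitz means $\|g_h(u)-g_h(v)\|\le\ell_g\|u-v\|$. Coefficients: $a_{i+1,j}(z)$ ($1\le j\le i\le s$) are entire functions, real on the real axis (constructed from linear combinations of $\varphi_k(cz)$, where $\varphi_0(z)=e^z$, $\varphi_{k+1}(z)=(\varphi_k(z)-1/k!)/z$), with $a_{i+1,i}(z)\ne0$ for $1\le i\le s$ (and $z\le 0$), and satisfying $\sum_{j=1}^{i}a_{i+1,j}(z)=(e^{c_{i+1}z}-1)/z$ for abscissas $c_2,\dots,c_s\in(0,1]$, $c_1=0$, $c_{s+1}=1$. For a function $f$, $f(-\tau L_\kappa)$ is the matrix function defined through the spectrum of the symmetric matrix $-\tau L_\kappa$. Difference coefficients: $\underline a_{i+1,i}:=a_{i+1,i}$, and $\underline a_{i+1,j}:=a_{i+1,j}-a_{i,j}$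 for $1\le j\le i-1$, $1\le i\le s$. Discrete orthogonal convolution (DOC) kernels: $\underline\theta_{k,k}:=1/\underline a_{k+1,k}$ and $\underline\theta_{k,j}:=-\sum_{\ell=j+1}^{k}\underline\theta_{k,\ell}\,\underline a_{\ell+1,j}/\underline a_{j+1,j}$ for $1\le j\le k-1$. Differentiation matrix: $d_{k\ell}(z):=\underline\theta_{k\ell}(z)+\frac z2(2-\delta_{k\ell})$ for $1\le\ell\le k\le s$ ($\delta_{k\ell}$ the Kronecker delta), and $d_{k\ell}(z):=0$ for $\ell>k$. *)

theory Defs
  imports "HOL-Analysis.Analysis"
begin

definition sym_pos_def :: "real ^ 'm ^ 'm \<Rightarrow> bool" where
  "sym_pos_def A \<longleftrightarrow> transpose A = A \<and> (\<forall>v. v \<noteq> 0 \<longrightarrow> 0 < (A *v v) \<bullet> v)"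

text \<open>A real \<open>s \<times> s\<close> matrix is a function on indices, of which only the values on
  \<open>{1..s} \<times> {1..s}\<close> matter.\<close>

definition sym_pos_semidef :: "nat \<Rightarrow> (nat \<Rightarrow> nat \<Rightarrow> real) \<Rightarrow> bool" where
  "sym_pos_semidef s B \<longleftrightarrow>
     (\<forall>k\<in>{1..s}. \<forall>l\<in>{1..s}. B k l = B l k) \<and>
     (\<forall>x :: nat \<Rightarrow> real. 0 \<le> (\<Sum>k=1..s. \<Sum>l=1..s. x k * B k l * x l))"

definition diag :: "('m \<Rightarrow> real) \<Rightarrow> real ^ 'm ^ 'm" where
  "diag d = (\<chi> i j. if i = j then d i else 0)"

text \<open>\<open>matfun f A\<close> is \<open>f(A) = Q diag(f(\<lambda>\<^sub>1), f(\<lambda>\<^sub>2), \<dots>) Q\<^sup>T\<close> for an orthogonal diagonalisation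
  \<open>A = Q diag(\<lambda>\<^sub>1, \<lambda>\<^sub>2, \<dots>) Q\<^sup>T\<close> of a symmetric matrix. The result does not depend on the
  diagonalisation (lemma \<open>matfun_diag\<close>); it is unspecified for non-symmetric \<open>A\<close>.\<close>

definition matfun :: "(real \<Rightarrow> real) \<Rightarrow> real ^ 'm ^ 'm \<Rightarrow> real ^ 'm ^ 'm" where
  "matfun f A = (THE B. \<exists>Q d. orthogonal_matrix Q \<and>
      A = Q ** diag d ** transpose Q \<and> B = Q ** diag (f \<circ> d) ** transpose Q)"

lemma diag_mult_left: "(diag d ** W) $ i $ j = d i * W $ i $ j"
  unfolding diag_def matrix_matrix_mult_def
  by (simp add: if_distrib [where f = "\<lambda>x. x * _"] cong: if_cong)

lemma diag_mult_right: "(W ** diag d) $ i $ j = W $ i $ j * d j"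
  unfolding diag_def matrix_matrix_mult_def
  by (simp add: if_distrib [where f = "\<lambda>x. _ * x"] cong: if_cong)

lemma matfun_diag:
  fixes Q :: "real ^ 'm ^ 'm"
  assumes Q: "orthogonal_matrix Q"
  shows "matfun f (Q ** diag d ** transpose Q) = Q ** diag (f \<circ> d) ** transpose Q"
  unfolding matfun_def
proof (rule the_equality)
  show "\<exists>Q' d'. orthogonal_matrix Q' \<and> Q ** diag d ** transpose Q = Q' ** diag d' ** transpose Q' \<and>
      Q ** diag (f \<circ> d) ** transpose Q = Q' ** diag (f \<circ> d') ** transpose Q'"
    using Q by blast
next
  fix B
  assume "\<exists>R e. orthogonal_matrix R \<and> Q ** diag d ** transpose Q = R ** diag e ** transpose R \<and>
      B = R ** diag (f \<circ> e) ** transpose R"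
  then obtain R e where R: "orthogonal_matrix R"
    and eq: "Q ** diag d ** transpose Q = R ** diag e ** transpose R"
    and B: "B = R ** diag (f \<circ> e) ** transpose R" by blast
  have QQ: "transpose Q ** Q = mat 1" "Q ** transpose Q = mat 1"
    and RR: "transpose R ** R = mat 1" "R ** transpose R = mat 1"
    using Q R by (auto simp: orthogonal_matrix_def)
  define W where "W = transpose R ** Q"
  have "W ** diag d = transpose R ** (Q ** diag d ** transpose Q) ** Q"
    by (metis W_def QQ(1) matrix_mul_assoc matrix_mul_rid)
  also have "\<dots> = transpose R ** (R ** diag e ** transpose R) ** Q"
    by (simp only: eq)
  also have "\<dots> = diag e ** W"
    by (metis W_def RR(1) matrix_mul_assoc matrix_mul_lid)
  finally have 1: "W ** diag d = diag e ** W" .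
  have "W $ i $ j * f (d j) = f (e i) * W $ i $ j" for i j
  proof -
    have "W $ i $ j * d j = e i * W $ i $ j"
      using arg_cong [OF 1, of "\<lambda>X. X $ i $ j"] by (simp add: diag_mult_left diag_mult_right)
    then show ?thesis by (cases "W $ i $ j = 0") auto
  qed
  then have 2: "W ** diag (f \<circ> d) = diag (f \<circ> e) ** W"
    by (simp add: vec_eq_iff diag_mult_left diag_mult_right)
  have "Q ** diag (f \<circ> d) ** transpose Q = R ** (W ** diag (f \<circ> d)) ** transpose Q"
    by (metis W_def RR(2) matrix_mul_assoc matrix_mul_lid)
  also have "\<dots> = R ** (diag (f \<circ> e) ** W) ** transpose Q"
    by (simp only: 2)
  also have "\<dots> = B"
    by (metis B W_def QQ(2) matrix_mul_assoc matrix_mul_rid)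
  finally show "B = Q ** diag (f \<circ> d) ** transpose Q" ..
qed

text \<open>Only used for functions that are real on the real axis.\<close>

definition on_reals :: "(complex \<Rightarrow> complex) \<Rightarrow> real \<Rightarrow> real" where
  "on_reals f x = Re (f (of_real x))"

definition energy ::
    "real ^ 'm ^ 'm \<Rightarrow> (real ^ 'm \<Rightarrow> real ^ 'm) \<Rightarrow> real ^ 'm \<Rightarrow> real" where
  "energy L G v = 1 / 2 * (v \<bullet> (L *v v)) + G v \<bullet> 1"

definition stab_L :: "real \<Rightarrow> real ^ 'm ^ 'm \<Rightarrow> real ^ 'm ^ 'm" where
  "stab_L \<kappa> L = L + \<kappa> *\<^sub>R mat 1"

definition stab_g :: "real \<Rightarrow> (real ^ 'm \<Rightarrow> real ^ 'm) \<Rightarrow> real ^ 'm \<Rightarrow> real ^ 'm" where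
  "stab_g \<kappa> g u = g u + \<kappa> *\<^sub>R u"

text \<open>Throughout, \<open>a i j\<close> stands for the coefficient \<open>a\<^sub>i\<^sub>,\<^sub>j\<close>, used for \<open>2 \<le> i \<le> s + 1\<close> and
  \<open>1 \<le> j < i\<close> only. The row-sum condition is imposed for \<open>z \<noteq> 0\<close>; its value \<open>c i\<close> at the
  removable singularity \<open>z = 0\<close> follows by continuity.\<close>

definition EERK_coeffs :: "nat \<Rightarrow> (nat \<Rightarrow> real) \<Rightarrow> (nat \<Rightarrow> nat \<Rightarrow> complex \<Rightarrow> complex) \<Rightarrow> bool" where
  "EERK_coeffs s c a \<longleftrightarrow>
     c 1 = 0 \<and> (\<forall>i\<in>{2..s}. 0 < c i \<and> c i \<le> 1) \<and> c (s + 1) = 1 \<and>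
     (\<forall>i\<in>{1..s}. \<forall>j\<in>{1..i}. a (i + 1) j holomorphic_on UNIV \<and>
        (\<forall>x::real. a (i + 1) j (of_real x) \<in> \<real>)) \<and>
     (\<forall>i\<in>{1..s}. \<forall>x\<le>0::real. a (i + 1) i (of_real x) \<noteq> 0) \<and>
     (\<forall>i\<in>{1..s}. \<forall>z. z \<noteq> 0 \<longrightarrow>
        (\<Sum>j=1..i. a (i + 1) j z) = (exp (of_real (c (i + 1)) * z) - 1) / z)"

text \<open>\<open>U n i\<close> is the stage value \<open>U\<^sup>n\<^sup>,\<^sup>i\<close>, \<open>u n\<close> the solution \<open>u\<^sup>n\<close>, and \<open>u 0\<close> is
  arbitrary.\<close>

definition EERK_solution ::
    "nat \<Rightarrow> (nat \<Rightarrow> nat \<Rightarrow> real \<Rightarrow> real) \<Rightarrow> real ^ 'm ^ 'm \<Rightarrow> (real ^ 'm \<Rightarrow> real ^ 'm) \<Rightarrow> real \<Rightarrow>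
     (nat \<Rightarrow> nat \<Rightarrow> real ^ 'm) \<Rightarrow> (nat \<Rightarrow> real ^ 'm) \<Rightarrow> bool" where
  "EERK_solution s a L g \<tau> U u \<longleftrightarrow> (\<forall>n\<ge>1.
     U n 1 = u (n - 1) \<and>
     (\<forall>i\<in>{1..s}. U n (i + 1) = U n 1 +
        (\<Sum>j=1..i. matfun (a (i + 1) j) (- \<tau> *\<^sub>R L) *v (\<tau> *\<^sub>R g (U n j) - \<tau> *\<^sub>R (L *v U n 1)))) \<and>
     u n = U n (s + 1))"

text \<open>\<open>diff_coeff a i j\<close> is the underlined coefficient, with the same indices \<open>i\<close>, \<open>j\<close> as
  \<open>a i j\<close>.\<close>

definition diff_coeff :: "(nat \<Rightarrow> nat \<Rightarrow> real \<Rightarrow> real) \<Rightarrow> nat \<Rightarrow> nat \<Rightarrow> real \<Rightarrow> real" where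
  "diff_coeff a i j z = (if i = j + 1 then a i j z else a i j z - a (i - 1) j z)"

text \<open>\<open>DOC a k j\<close> is the discrete orthogonal convolution kernel; only \<open>1 \<le> j \<le> k\<close> is
  meaningful.\<close>

function DOC :: "(nat \<Rightarrow> nat \<Rightarrow> real \<Rightarrow> real) \<Rightarrow> nat \<Rightarrow> nat \<Rightarrow> real \<Rightarrow> real" where
  "DOC a k j z =
     (if j < k
      then - (\<Sum>l=j+1..k. DOC a k l z * diff_coeff a (l + 1) j z / diff_coeff a (j + 1) j z)
      else 1 / diff_coeff a (k + 1) k z)"
  by auto
termination
  by (relation "Wellfounded.measure (\<lambda>(a, k, j, z). k - j)") auto

declare DOC.simps [simp del]

definition diffmat :: "(nat \<Rightarrow> nat \<Rightarrow> real \<Rightarrow> real) \<Rightarrow> nat \<Rightarrow> nat \<Rightarrow> real \<Rightarrow> real" where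
  "diffmat a k l z =
     (if l \<le> k then DOC a k l z + z / 2 * (2 - (if k = l then 1 else 0)) else 0)"

definition sym_part :: "(nat \<Rightarrow> nat \<Rightarrow> real) \<Rightarrow> nat \<Rightarrow> nat \<Rightarrow> real" where
  "sym_part B k l = 1 / 2 * (B k l + B l k)"

end

(* Write z for -\<tau> L_\<kappa>. Differencing consecutive stages gives
   \<delta>U_i = sum_j diff_coeff_{i+1,j}(z) (\<tau> g_\<kappa>(U_j) + z U_1); the DOC kernels invert this triangular
   system, and the z/2 terms of D turn U_1 into the midpoint (U_k + U_{k+1})/2:
   sum_l d_{kl}(z) \<delta>U_l = \<tau> g_\<kappa>(U_k) - \<tau> L_\<kappa> (U_k + U_{k+1})/2.
   Tested with \<delta>U_k, the midpoint yields the exact increment of the quadratic energy, and the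
   stabilisation contributes \<kappa>/2 |\<delta>U_k|^2, which absorbs the linearisation error of the Lyapunov
   part. Diagonalising L_\<kappa> reduces the sign of the right-hand side to the semidefiniteness
   of D at the eigenvalues of z, which are nonpositive. *)

theory Submission
  imports Defs
begin

section \<open>Spectral theorem for real symmetric matrices\<close>

text \<open>A maximiser of the Rayleigh quotient over the compact unit sphere of \<open>S\<close> is
  an eigenvector: invariance of \<open>S\<close> keeps the residual
  \<open>\<mu> *\<^sub>R e - f e\<close> in \<open>S\<close>, so maximality can be tested in its
  direction.\<close>

lemma selfadjoint_eigenvector_exists:
  fixes f :: "'a::euclidean_space \<Rightarrow> 'a"
  assumes f: "linear f" and sa: "\<And>x y. f x \<bullet> y = x \<bullet> f y"
    and S: "subspace S" "\<And>x. x \<in> S \<Longrightarrow> f x \<in> S" "S \<noteq> {0}"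
  obtains e \<mu> where "e \<in> S" "norm e = 1" "f e = \<mu> *\<^sub>R e"
proof -
  let ?K = "S \<inter> sphere 0 1"
  have "compact ?K"
    using closed_subspace [OF S(1)] by (intro closed_Int_compact) auto
  moreover obtain x where x: "x \<in> S" "x \<noteq> 0"
    using S(1,3) subspace_0 by blast
  then have "x /\<^sub>R norm x \<in> ?K"
    using S(1) by (simp add: subspace_scale)
  then have "?K \<noteq> {}" by blast
  moreover have "continuous_on ?K (\<lambda>x. x \<bullet> f x)"
    using f by (intro continuous_intros linear_continuous_on) (simp add: linear_conv_bounded_linear)
  ultimately obtain e where e: "e \<in> ?K" and max: "\<And>x. x \<in> ?K \<Longrightarrow> x \<bullet> f x \<le> e \<bullet> f e"
    using continuous_attains_sup [of ?K "\<lambda>x. x \<bullet> f x"] by metis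
  define \<mu> where "\<mu> = e \<bullet> f e"
  have ee: "e \<bullet> e = 1" and eS: "e \<in> S"
    using e by (auto simp: dot_square_norm)
  \<comment> \<open>Homogeneity extends the bound from the unit sphere to all of
    \<open>S\<close>.\<close>
  have le: "x \<bullet> f x \<le> \<mu> * (x \<bullet> x)" if "x \<in> S" for x
  proof (cases "x = 0")
    case False
    then have "x /\<^sub>R norm x \<in> ?K"
      using S(1) that by (simp add: subspace_scale)
    from max [OF this] have "inverse (norm x) * (inverse (norm x) * (x \<bullet> f x)) \<le> \<mu>"
      by (simp only: linear_scale [OF f] \<mu>_def inner_scaleR_left inner_scaleR_right)
    then have "(x \<bullet> f x) / (norm x)\<^sup>2 \<le> \<mu>"
      by (simp add: power2_eq_square divide_inverse mult_ac)
    then show ?thesis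
      using False by (simp add: dot_square_norm pos_divide_le_eq)
  qed simp
  define y where "y = \<mu> *\<^sub>R e - f e"
  have yS: "y \<in> S"
    unfolding y_def using S(1,2) eS by (simp add: subspace_diff subspace_scale)
  define b where "b = y \<bullet> y"
  define q where "q = \<mu> * (y \<bullet> y) - y \<bullet> f y"
  have q: "q \<ge> 0"
    using le [OF yS] by (simp add: q_def)
  \<comment> \<open>The form \<open>\<mu> |x|\<^sup>2 - x \<bullet> f x\<close> is nonnegative on \<open>S\<close> and vanishes at \<open>e\<close>, so its first
    variation at \<open>e\<close> vanishes.\<close>
  have var: "0 \<le> 2 * t * b + t\<^sup>2 * q" for t
  proof -
    have "e + t *\<^sub>R y \<in> S"
      using S(1) eS yS by (simp add: subspace_add subspace_scale)
    from le [OF this]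
    have "0 \<le> \<mu> * ((e + t *\<^sub>R y) \<bullet> (e + t *\<^sub>R y)) - (e + t *\<^sub>R y) \<bullet> f (e + t *\<^sub>R y)" by simp
    also have "\<dots> = (\<mu> * (e \<bullet> e) - \<mu>) + 2 * t * (\<mu> * (e \<bullet> y) - f e \<bullet> y) + t\<^sup>2 * q"
      using sa [of e y]
      by (simp add: linear_add [OF f] linear_scale [OF f] inner_add_left inner_add_right
          inner_commute [of y e] inner_commute [of y "f e"] power2_eq_square \<mu>_def q_def
          distrib_left right_diff_distrib mult_ac)
    also have "\<mu> * (e \<bullet> y) - f e \<bullet> y = b"
      by (simp add: b_def y_def inner_diff_left)
    finally show ?thesis by (simp add: ee)
  qed
  \<comment> \<open>The right-hand side of \<open>var\<close> is smallest at
    \<open>t = - b / q\<close>; taking \<open>q + 1\<close> instead also covers \<open>q = 0\<close>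
    and still gives a negative value unless \<open>b = 0\<close>.\<close>
  have "0 \<le> 2 * (- b / (q + 1)) * b + (- b / (q + 1))\<^sup>2 * q"
    by (rule var)
  also have "\<dots> = - (b\<^sup>2 * (q + 2) / (q + 1)\<^sup>2)"
    using q by (simp add: divide_simps power2_eq_square) (simp add: algebra_simps)
  finally have "b\<^sup>2 * (q + 2) / (q + 1)\<^sup>2 \<le> 0" by simp
  then have "b = 0"
    using q by (auto simp: divide_le_0_iff mult_le_0_iff)
  then have "f e = \<mu> *\<^sub>R e"
    by (simp add: b_def y_def)
  with e that show thesis by auto
qed

text \<open>Split off a unit eigenvector \<open>e\<close> and recurse on its complement in
  \<open>S\<close>, which is again invariant since
  \<open>e \<bullet> f x = f e \<bullet> x = \<mu> * (e \<bullet> x)\<close>. An arbitrary invariant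
  \<open>S\<close> is what the induction needs; the application has \<open>S = UNIV\<close>.\<close>

lemma selfadjoint_orthonormal_eigenbasis:
  fixes f :: "'a::euclidean_space \<Rightarrow> 'a"
  assumes f: "linear f" and sa: "\<And>x y. f x \<bullet> y = x \<bullet> f y"
    and "subspace S" "\<And>x. x \<in> S \<Longrightarrow> f x \<in> S"
  shows "\<exists>B \<subseteq> S. pairwise orthogonal B \<and> (\<forall>b\<in>B. norm b = 1 \<and> (\<exists>\<mu>. f b = \<mu> *\<^sub>R b)) \<and> S \<subseteq> span B"
  using assms(3,4)
proof (induction "dim S" arbitrary: S rule: less_induct)
  case less
  show ?case
  proof (cases "S = {0}")
    case True
    then show ?thesis by (intro exI [of _ "{}"]) auto
  next
    case False
    obtain e \<mu> where e: "e \<in> S" "norm e = 1" "f e = \<mu> *\<^sub>R e"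
      using selfadjoint_eigenvector_exists [OF f sa less.prems False] by blast
    have ee: "e \<bullet> e = 1"
      using e(2) by (simp add: dot_square_norm)
    define T where "T = S \<inter> {x. e \<bullet> x = 0}"
    have T: "subspace T"
      unfolding T_def by (intro subspace_inter less.prems(1) subspace_hyperplane)
    have fT: "f x \<in> T" if "x \<in> T" for x
      using that less.prems(2) sa [of e x] by (simp add: T_def e(3))
    have "e \<notin> T"
      using ee by (simp add: T_def)
    moreover have "T \<subseteq> S"
      by (auto simp: T_def)
    ultimately have "T \<subset> S"
      using e(1) by blast
    then have "dim T < dim S"
      using T less.prems(1) by (metis dim_psubset span_eq_iff)
    from less.hyps [OF this T fT] obtain B where B: "B \<subseteq> T" "pairwise orthogonal B"
      "\<forall>b\<in>B. norm b = 1 \<and> (\<exists>\<mu>. f b = \<mu> *\<^sub>R b)" "T \<subseteq> span B" by blast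
    have "S \<subseteq> span (insert e B)"
    proof
      fix x assume "x \<in> S"
      then have "x - (e \<bullet> x) *\<^sub>R e \<in> T"
        using less.prems(1) e(1) ee
        by (simp add: T_def subspace_diff subspace_scale inner_diff_right)
      with B(4) show "x \<in> span (insert e B)"
        unfolding span_breakdown_eq by blast
    qed
    moreover have "pairwise orthogonal (insert e B)"
      using B(1,2) by (auto simp: pairwise_insert T_def orthogonal_def inner_commute)
    ultimately show ?thesis
      using B e T_def by (intro exI [of _ "insert e B"]) auto
  qed
qed

lemma symmetric_matrix_inner:
  fixes A :: "real ^ 'm ^ 'm"
  assumes "transpose A = A"
  shows "(A *v x) \<bullet> y = x \<bullet> (A *v y)"
  using assms by (metis dot_lmul_matrix vector_transpose_matrix inner_commute)

text \<open>An orthonormal eigenbasis has as many elements as the index type, so it can be indexed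
  by that type and its vectors used as the columns of \<open>Q\<close>.\<close>

theorem symmetric_matrix_orthogonally_diagonalizable:
  fixes A :: "real ^ 'm ^ 'm"
  assumes "transpose A = A"
  obtains Q d where "orthogonal_matrix Q" "A = Q ** diag d ** transpose Q"
proof -
  have sa: "(A *v x) \<bullet> y = x \<bullet> (A *v y)" for x y
    using assms by (rule symmetric_matrix_inner)
  obtain B :: "(real ^ 'm) set" where B: "pairwise orthogonal B"
    "\<And>b. b \<in> B \<Longrightarrow> norm b = 1" "\<And>b. b \<in> B \<Longrightarrow> \<exists>\<mu>. A *v b = \<mu> *\<^sub>R b" "span B = UNIV"
    using selfadjoint_orthonormal_eigenbasis [of "(*v) A" UNIV] sa top.extremum_unique
    by (metis UNIV_I matrix_vector_mul_linear subspace_UNIV)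
  have "0 \<notin> B" using B(2) by force
  then have indep: "independent B" using B(1) pairwise_orthogonal_independent by blast
  then have fin: "finite B" by (rule independent_imp_finite)
  have "card B = CARD('m)"
    using dim_eq_card_independent [OF indep] B(4) by (metis dim_span dim_UNIV DIM_cart DIM_real mult_1_right)
  then obtain h :: "'m \<Rightarrow> real ^ 'm" where h: "bij_betw h UNIV B"
    using finite_same_card_bij [of "UNIV :: 'm set" B] fin by auto
  then have hB: "h i \<in> B" for i by (auto simp: bij_betw_def)
  obtain d where d: "A *v h j = d j *\<^sub>R h j" for j
    using B(3) [OF hB] by metis
  define Q :: "real ^ 'm ^ 'm" where "Q = (\<chi> i j. h j $ i)"
  have col: "column j Q = h j" for j
    by (simp add: column_def Q_def vec_eq_iff)
  have Q: "orthogonal_matrix Q"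
    unfolding orthogonal_matrix_orthonormal_columns col
    using B(1) B(2) [OF hB] hB h by (metis bij_betw_def injD pairwise_def)
  have "(A ** Q) $ i $ j = (Q ** diag d) $ i $ j" for i j
  proof -
    have "(A ** Q) $ i $ j = (A *v h j) $ i"
      by (simp add: matrix_matrix_mult_def matrix_vector_mult_def Q_def)
    then show ?thesis by (simp add: d diag_mult_right Q_def)
  qed
  then have "A ** Q = Q ** diag d" by (simp add: vec_eq_iff)
  then have "A = Q ** diag d ** transpose Q"
    using Q by (metis matrix_mul_assoc matrix_mul_rid orthogonal_matrix_def)
  with Q that show thesis by blast
qed

section \<open>Coordinates with respect to an eigenbasis\<close>

text \<open>The same \<open>Q\<close> diagonalises every function of \<open>A\<close>. In the
  coordinates \<open>transpose Q *v x\<close> a matrix recurrence thus splits into scalar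
  recurrences, one for each eigenvalue \<open>d m\<close>.\<close>

lemma transpose_matfun_component:
  fixes Q :: "real ^ 'm ^ 'm"
  assumes Q: "orthogonal_matrix Q" and A: "A = Q ** diag d ** transpose Q"
  shows "(transpose Q *v (matfun f A *v x)) $ m = f (d m) * (transpose Q *v x) $ m"
proof -
  have "transpose Q *v (matfun f A *v x) = diag (f \<circ> d) *v (transpose Q *v x)"
    using Q unfolding A matfun_diag [OF Q] orthogonal_matrix_def
    by (metis matrix_vector_mul_assoc matrix_mul_assoc matrix_mul_lid)
  then show ?thesis
    by (simp add: diag_def matrix_vector_mult_def if_distrib [where f = "\<lambda>x. x * _"] cong: if_cong)
qed

lemma transpose_diagonalized_component:
  fixes Q :: "real ^ 'm ^ 'm"
  assumes Q: "orthogonal_matrix Q" and A: "A = Q ** diag d ** transpose Q"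
  shows "(transpose Q *v (A *v x)) $ m = d m * (transpose Q *v x) $ m"
proof -
  have "matfun (\<lambda>z. z) A = A"
    using matfun_diag [OF Q, of "\<lambda>z. z" d] by (simp add: A comp_def)
  then show ?thesis
    using transpose_matfun_component [OF assms, of "\<lambda>z. z"] by simp
qed

lemma orthogonal_matrix_inner_transpose:
  fixes Q :: "real ^ 'm ^ 'm"
  assumes "orthogonal_matrix Q"
  shows "(transpose Q *v x) \<bullet> (transpose Q *v y) = x \<bullet> y"
  using assms orthogonal_transformation_matrix [of "(*v) (transpose Q)"]
  by (simp add: orthogonal_transformation_def orthogonal_matrix_transpose)

lemma orthogonal_matrix_transpose_inject:
  fixes Q :: "real ^ 'm ^ 'm"
  assumes "orthogonal_matrix Q" "transpose Q *v x = transpose Q *v y"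
  shows "x = y"
  using assms by (metis matrix_vector_mul_assoc matrix_vector_mul_lid orthogonal_matrix_def)

lemma nonpos_form_imp_diagonal_nonpos:
  fixes Q :: "real ^ 'm ^ 'm"
  assumes Q: "orthogonal_matrix Q" and A: "A = Q ** diag d ** transpose Q"
    and nonpos: "\<And>v. (A *v v) \<bullet> v \<le> 0"
  shows "d m \<le> 0"
proof -
  \<comment> \<open>The \<open>m\<close>-th column of \<open>Q\<close>, an eigenvector of
    \<open>A\<close> for \<open>d m\<close>.\<close>
  define v where "v = Q *v axis m 1"
  have Qv: "transpose Q *v v = axis m 1"
    using Q by (simp add: v_def matrix_vector_mul_assoc orthogonal_matrix_def)
  have "(A *v v) \<bullet> v = (transpose Q *v (A *v v)) \<bullet> axis m 1"
    using orthogonal_matrix_inner_transpose [OF Q, of "A *v v" v] by (simp only: Qv)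
  also have "\<dots> = d m"
    by (simp only: inner_axis transpose_diagonalized_component [OF Q A] Qv) simp
  finally show ?thesis using nonpos [of v] by simp
qed

section \<open>DOC kernels and the differentiation matrix\<close>

text \<open>The recursion for \<open>DOC a k j\<close> is the vanishing of this sum for
  \<open>j < k\<close>, solved for its first term. The kernels are therefore the entries of a left
  inverse of the triangular matrix of difference coefficients.\<close>

lemma DOC_orthogonality:
  assumes nz: "\<And>i. i \<in> {1..k} \<Longrightarrow> diff_coeff a (i + 1) i z \<noteq> 0"
    and j: "1 \<le> j" "j \<le> k"
  shows "(\<Sum>l=j..k. DOC a k l z * diff_coeff a (l + 1) j z) = (if j = k then 1 else 0)"
proof (cases "j = k")
  case True
  then show ?thesis using nz [of k] j by (simp add: DOC.simps [of a k k])
next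
  case False
  with j have "j < k" by simp
  then have "(\<Sum>l=j..k. DOC a k l z * diff_coeff a (l + 1) j z) =
      DOC a k j z * diff_coeff a (j + 1) j z + (\<Sum>l=j+1..k. DOC a k l z * diff_coeff a (l + 1) j z)"
    using sum.atLeast_Suc_atMost [of j k] by simp
  also have "DOC a k j z * diff_coeff a (j + 1) j z =
      - (\<Sum>l=j+1..k. DOC a k l z * diff_coeff a (l + 1) j z)"
    using \<open>j < k\<close> nz [of j] j
    by (subst DOC.simps) (simp add: sum_divide_distrib [symmetric])
  finally show ?thesis using False by simp
qed

lemma DOC_inversion:
  fixes x y :: "nat \<Rightarrow> real"
  assumes nz: "\<And>i. i \<in> {1..k} \<Longrightarrow> diff_coeff a (i + 1) i z \<noteq> 0"
    and x: "\<And>i. i \<in> {1..k} \<Longrightarrow> x i = (\<Sum>j=1..i. diff_coeff a (i + 1) j z * y j)"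
    and k: "k \<ge> 1"
  shows "(\<Sum>l=1..k. DOC a k l z * x l) = y k"
proof -
  have "(\<Sum>l=1..k. DOC a k l z * x l) =
      (\<Sum>l=1..k. \<Sum>j=1..l. DOC a k l z * diff_coeff a (l + 1) j z * y j)"
    by (simp add: x sum_distrib_left mult.assoc)
  \<comment> \<open>Both double sums run over the triangle
    \<open>1 \<le> j \<le> l \<le> k\<close>.\<close>
  also have "\<dots> = (\<Sum>j=1..k. \<Sum>l=j..k. DOC a k l z * diff_coeff a (l + 1) j z * y j)"
    unfolding sum.Sigma [OF finite_atLeastAtMost ballI, OF finite_atLeastAtMost]
    by (rule sum.reindex_bij_witness [of _ "\<lambda>(i, j). (j, i)" "\<lambda>(i, j). (j, i)"]) auto
  also have "\<dots> = (\<Sum>j=1..k. (if j = k then 1 else 0) * y j)"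
    using DOC_orthogonality [OF nz] by (intro sum.cong) (auto simp flip: sum_distrib_right)
  also have "\<dots> = y k"
    using k by (simp add: if_distrib [where f = "\<lambda>x. x * _"] cong: if_cong)
  finally show ?thesis .
qed

lemma diff_coeff_increment:
  fixes w y :: "nat \<Rightarrow> real"
  assumes w: "\<And>i. i \<in> {1..s} \<Longrightarrow> w (i + 1) = w 1 + (\<Sum>j=1..i. a (i + 1) j z * y j)"
    and i: "i \<in> {1..s}"
  shows "w (i + 1) - w i = (\<Sum>j=1..i. diff_coeff a (i + 1) j z * y j)"
\<comment> \<open>For \<open>i = 1\<close> the value subtracted is \<open>w 1\<close> itself, which
  carries no sum; for larger \<open>i\<close> it comes from the formula one stage earlier.\<close>
proof (cases "i = 1")
  case True
  then show ?thesis using w [OF i] by (simp add: diff_coeff_def)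
next
  case False
  then obtain p where p: "i = Suc p" "p \<ge> 1"
    using i by (cases i) auto
  have "w i = w 1 + (\<Sum>j=1..p. a i j z * y j)"
    using w [of p] p i by simp
  then have "w (i + 1) - w i = a (i + 1) i z * y i + (\<Sum>j=1..p. (a (i + 1) j z - a i j z) * y j)"
    using w [OF i] p by (simp add: sum_subtractf left_diff_distrib)
  also have "\<dots> = (\<Sum>j=1..i. diff_coeff a (i + 1) j z * y j)"
    using p by (simp add: diff_coeff_def)
  finally show ?thesis .
qed

text \<open>This is the stage identity in one eigencoordinate: \<open>w\<close> are the stages,
  \<open>z\<close> is the eigenvalue and \<open>\<gamma>\<close> the scaled nonlinearity. The
  kernels recover \<open>\<gamma> k + z * w 1\<close>, and the remaining terms of
  \<open>diffmat\<close> move \<open>w 1\<close> to the midpoint.\<close>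

lemma diffmat_increments:
  fixes w \<gamma> :: "nat \<Rightarrow> real"
  assumes nz: "\<And>i. i \<in> {1..s} \<Longrightarrow> a (i + 1) i z \<noteq> 0"
    and w: "\<And>i. i \<in> {1..s} \<Longrightarrow> w (i + 1) = w 1 + (\<Sum>j=1..i. a (i + 1) j z * (\<gamma> j + z * w 1))"
    and k: "k \<in> {1..s}"
  shows "(\<Sum>l=1..k. diffmat a k l z * (w (l + 1) - w l)) = \<gamma> k + z * ((w k + w (k + 1)) / 2)"
proof -
  obtain p where p: "k = Suc p" using k by (cases k) auto
  have "(\<Sum>l=1..k. DOC a k l z * (w (l + 1) - w l)) = \<gamma> k + z * w 1"
    using k nz diff_coeff_increment [of s w a z "\<lambda>j. \<gamma> j + z * w 1", OF w]
    by (intro DOC_inversion) (auto simp: diff_coeff_def)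
  moreover have "(\<Sum>l=1..p. w (l + 1) - w l) = w k - w 1"
    using sum_Suc_diff [of 1 p w] by (simp add: p)
  \<comment> \<open>The weight is \<open>z\<close> on the increments before \<open>k\<close>, which
    telescope, and only \<open>z / 2\<close> on the last one.\<close>
  then have "(\<Sum>l=1..k. z / 2 * (2 - (if k = l then 1 else 0)) * (w (l + 1) - w l)) =
      z * (w k - w 1) + z / 2 * (w (k + 1) - w k)"
    by (simp add: p sum_distrib_left [symmetric])
  moreover have "(\<Sum>l=1..k. diffmat a k l z * (w (l + 1) - w l)) =
      (\<Sum>l=1..k. DOC a k l z * (w (l + 1) - w l)) +
      (\<Sum>l=1..k. z / 2 * (2 - (if k = l then 1 else 0)) * (w (l + 1) - w l))"
    unfolding sum.distrib [symmetric] by (intro sum.cong) (auto simp: diffmat_def distrib_right)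
  ultimately show ?thesis by (simp add: field_simps)
qed

text \<open>A matrix and its symmetric part have the same quadratic form. Extending \<open>x\<close>
  by zero beyond \<open>j\<close> turns the form of size \<open>s\<close> into its leading part,
  which gives the sign at every intermediate stage.\<close>

lemma sym_pos_semidef_lower_triangular:
  fixes x :: "nat \<Rightarrow> real"
  assumes psd: "sym_pos_semidef s (sym_part B)" and lower: "\<And>k l. k < l \<Longrightarrow> B k l = 0"
    and j: "j \<le> s"
  shows "0 \<le> (\<Sum>k=1..j. \<Sum>l=1..k. x k * B k l * x l)"
proof -
  define y where "y k = (if k \<le> j then x k else 0)" for k
  have "0 \<le> (\<Sum>k=1..s. \<Sum>l=1..s. y k * sym_part B k l * y l)"
    using psd by (simp add: sym_pos_semidef_def)
  also have "\<dots> = (\<Sum>k=1..s. \<Sum>l=1..s. y k * B k l * y l) / 2 +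
      (\<Sum>k=1..s. \<Sum>l=1..s. y k * B l k * y l) / 2"
    by (simp add: sym_part_def sum.distrib [symmetric] sum_divide_distrib field_simps)
  also have "(\<Sum>k=1..s. \<Sum>l=1..s. y k * B l k * y l) = (\<Sum>k=1..s. \<Sum>l=1..s. y k * B k l * y l)"
    by (subst sum.swap) (simp add: mult.commute mult.left_commute)
  also have "(\<Sum>k=1..s. \<Sum>l=1..s. y k * B k l * y l) = (\<Sum>k=1..j. \<Sum>l=1..s. y k * B k l * y l)"
    using j by (intro sum.mono_neutral_right) (auto simp: y_def)
  also have "\<dots> = (\<Sum>k=1..j. \<Sum>l=1..k. x k * B k l * x l)"
  proof (rule sum.cong [OF refl])
    fix k assume k: "k \<in> {1..j}"
    have "(\<Sum>l=1..s. y k * B k l * y l) = (\<Sum>l=1..k. y k * B k l * y l)"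
      using k j lower by (intro sum.mono_neutral_right) auto
    also have "\<dots> = (\<Sum>l=1..k. x k * B k l * x l)"
      using k by (intro sum.cong) (auto simp: y_def)
    finally show "(\<Sum>l=1..s. y k * B k l * y l) = (\<Sum>l=1..k. x k * B k l * x l)" .
  qed
  finally show ?thesis by simp
qed

section \<open>Energy increment over a single stage\<close>

text \<open>The mean value theorem gives \<open>K\<close> where Taylor's formula with integral remainder gives
  \<open>K / 2\<close>; \<open>\<kappa> \<ge> 2 * lg\<close> leaves room for this loss.\<close>

lemma Lipschitz_gradient_upper_bound:
  fixes F :: "'a::real_inner \<Rightarrow> real"
  assumes F: "\<And>v. GDERIV F v :> - g v" and g: "K-lipschitz_on UNIV g"
  shows "F v - F u \<le> - (g u \<bullet> (v - u)) + K * ((v - u) \<bullet> (v - u))"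
proof -
  \<comment> \<open>The restriction of \<open>F\<close> to the line through \<open>u\<close> and
    \<open>v\<close>.\<close>
  let ?h = "\<lambda>t. F (u + t *\<^sub>R (v - u))"
  have deriv: "(?h has_real_derivative - g (u + t *\<^sub>R (v - u)) \<bullet> (v - u)) (at t)" for t
  proof -
    have "((\<lambda>t. u + t *\<^sub>R (v - u)) has_derivative (\<lambda>t. t *\<^sub>R (v - u))) (at t)"
      by (auto intro!: derivative_eq_intros)
    from has_derivative_compose [OF this F [unfolded gderiv_def]]
    show ?thesis
      unfolding has_field_derivative_def
      by (rule has_derivative_eq_rhs) (simp add: fun_eq_iff inner_commute)
  qed
  obtain t :: real where t: "0 < t" "t < 1" and
    eq: "?h 1 - ?h 0 = (1 - 0) * (- g (u + t *\<^sub>R (v - u)) \<bullet> (v - u))"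
    using MVT2 [of 0 1 ?h "\<lambda>t. - g (u + t *\<^sub>R (v - u)) \<bullet> (v - u)"] deriv by force
  have K: "K \<ge> 0" using g by (rule lipschitz_on_nonneg)
  have "(g u - g (u + t *\<^sub>R (v - u))) \<bullet> (v - u) \<le>
      norm (g u - g (u + t *\<^sub>R (v - u))) * norm (v - u)"
    by (rule norm_cauchy_schwarz)
  also have "\<dots> \<le> (K * norm (t *\<^sub>R (v - u))) * norm (v - u)"
    using lipschitz_onD [OF g, of u "u + t *\<^sub>R (v - u)"]
    by (intro mult_right_mono) (simp_all add: dist_norm)
  \<comment> \<open>Bounding \<open>t\<close> by 1 is where the factor 1/2 is lost, since the mean
    value theorem does not locate \<open>t\<close>.\<close>
  also have "\<dots> \<le> (K * norm (v - u)) * norm (v - u)"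
    using t K by (intro mult_right_mono mult_left_mono) (simp_all add: mult_left_le_one_le)
  also have "\<dots> = K * ((v - u) \<bullet> (v - u))"
    by (simp add: dot_square_norm power2_eq_square)
  finally show ?thesis using eq by (simp add: inner_diff_left)
qed

lemma stab_L_vec: "stab_L \<kappa> L *v x = L *v x + \<kappa> *\<^sub>R x"
  by (simp add: stab_L_def matrix_vector_mult_add_rdistrib scaleR_matrix_vector_assoc [symmetric])

text \<open>Symmetry of \<open>L\<close> makes the quadratic increment an exact midpoint expression,
  and the Lyapunov part is linearised at \<open>u\<close>. The only further loss is replacing
  \<open>lg\<close> by \<open>\<kappa> / 2\<close>.\<close>

lemma energy_increment_le:
  fixes L :: "real ^ 'm ^ 'm"
  assumes L: "transpose L = L"
    and G: "\<And>v. GDERIV (\<lambda>w. G w \<bullet> 1) v :> - g v" and g: "lg-lipschitz_on UNIV g"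
    and \<kappa>: "\<kappa> \<ge> 2 * lg"
  shows "energy L G v - energy L G u
    \<le> - ((v - u) \<bullet> (stab_g \<kappa> g u - stab_L \<kappa> L *v ((1 / 2) *\<^sub>R (u + v))))"
proof -
  have quad: "v \<bullet> (L *v v) - u \<bullet> (L *v u) = (v - u) \<bullet> (L *v (u + v))"
    using symmetric_matrix_inner [OF L, of u v] inner_commute [of v "L *v u"]
    by (simp add: matrix_vector_right_distrib inner_diff_left inner_add_right)
  have "energy L G v - energy L G u \<le>
      (v - u) \<bullet> (L *v (u + v)) / 2 - g u \<bullet> (v - u) + lg * ((v - u) \<bullet> (v - u))"
    using Lipschitz_gradient_upper_bound [OF G g, of v u] quad by (simp add: energy_def field_simps)
  also have "\<dots> \<le> (v - u) \<bullet> (L *v (u + v)) / 2 - g u \<bullet> (v - u) + \<kappa> / 2 * ((v - u) \<bullet> (v - u))"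
    using \<kappa> by (intro add_left_mono mult_right_mono) auto
  also have "\<dots> = - ((v - u) \<bullet> (stab_g \<kappa> g u - stab_L \<kappa> L *v ((1 / 2) *\<^sub>R (u + v))))"
  proof -
    \<comment> \<open>Half the increment is the midpoint minus \<open>u\<close>: the two terms are
      the stabilisations in \<open>stab_L\<close> and \<open>stab_g\<close>.\<close>
    have "\<kappa> / 2 * ((v - u) \<bullet> (v - u)) = \<kappa> * ((v - u) \<bullet> (u + v)) / 2 - \<kappa> * ((v - u) \<bullet> u)"
      by (simp add: inner_diff_left inner_diff_right inner_add_right inner_commute field_simps)
    then show ?thesis
      by (simp add: stab_g_def stab_L_vec matrix_vector_mult_scaleR inner_commute [of "g u"]
          inner_diff_right [of "v - u"] inner_add_right [of "v - u"]
          diff_divide_distrib add_divide_distrib distrib_left del: inner_diff_left)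
  qed
  finally show ?thesis .
qed

section \<open>Energy dissipation at all stages\<close>

theorem theorem2p1:
  fixes L :: "real ^ 'm ^ 'm"
    and G g :: "real ^ 'm \<Rightarrow> real ^ 'm"
    and \<kappa> lg \<tau> :: real
    and s :: nat
    and c :: "nat \<Rightarrow> real"
    and a :: "nat \<Rightarrow> nat \<Rightarrow> complex \<Rightarrow> complex"
    and U :: "nat \<Rightarrow> nat \<Rightarrow> real ^ 'm"
    and u :: "nat \<Rightarrow> real ^ 'm"
  defines "\<alpha> \<equiv> \<lambda>i j. on_reals (a i j)"
  defines "\<delta>U \<equiv> \<lambda>n k. U n (k + 1) - U n k"
  defines "R \<equiv> \<lambda>n j. - (1 / \<tau>) * (\<Sum>k=1..j. \<delta>U n k \<bullet>
      (\<Sum>l=1..k. matfun (diffmat \<alpha> k l) (- \<tau> *\<^sub>R stab_L \<kappa> L) *v \<delta>U n l))"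
  assumes L: "sym_pos_def L"
    and G_nonneg: "\<And>v i. 0 \<le> G v $ i"
    and G_grad: "\<And>v. GDERIV (\<lambda>w. G w \<bullet> 1) v :> - g v"
    and g_Lipschitz: "lg > 0" "lg-lipschitz_on UNIV g"
    and \<kappa>: "\<kappa> \<ge> 2 * lg"
    and s: "s \<ge> 1"
    and coeffs: "EERK_coeffs s c a"
    and D: "\<And>z. z \<le> 0 \<Longrightarrow> sym_pos_semidef s (sym_part (\<lambda>k l. diffmat \<alpha> k l z))"
    and \<tau>: "\<tau> > 0"
    and sol: "EERK_solution s \<alpha> (stab_L \<kappa> L) (stab_g \<kappa> g) \<tau> U u"
  shows "\<forall>n\<ge>1. (\<forall>j\<in>{1..s}.
             energy L G (U n (j + 1)) - energy L G (U n 1) \<le> R n j \<and> R n j \<le> 0)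
           \<and> energy L G (u n) - energy L G (u (n - 1)) \<le> R n s"
proof -
  define A where "A = - \<tau> *\<^sub>R stab_L \<kappa> L"
  have R_eq: "R n j = - (1 / \<tau>) *
      (\<Sum>k=1..j. \<delta>U n k \<bullet> (\<Sum>l=1..k. matfun (diffmat \<alpha> k l) A *v \<delta>U n l))" for n j
    by (simp only: R_def A_def)
  have LT: "transpose L = L" and Lpos: "(L *v v) \<bullet> v \<ge> 0" for v
    using L by (auto simp: sym_pos_def_def) (cases "v = 0"; simp add: less_imp_le)
  have Avec: "A *v x = - (\<tau> *\<^sub>R (stab_L \<kappa> L *v x))" for x
    unfolding A_def by (metis scaleR_matrix_vector_assoc scaleR_minus_left)
  have "transpose A = A"
    using LT by (simp add: A_def stab_L_def transpose_def mat_def vec_eq_iff)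
  then obtain Q d where Q: "orthogonal_matrix Q" and A_diag: "A = Q ** diag d ** transpose Q"
    by (rule symmetric_matrix_orthogonally_diagonalizable)
  have \<kappa>0: "\<kappa> \<ge> 0" using \<kappa> g_Lipschitz(1) by simp
  \<comment> \<open>The eigenvalues of \<open>A\<close> must lie in the range
    \<open>z \<le> 0\<close> where \<open>D\<close> and the nonvanishing of the diagonal
    coefficients are available.\<close>
  have "(A *v v) \<bullet> v \<le> 0" for v
    using \<tau> \<kappa>0 Lpos [of v] by (simp add: Avec stab_L_vec inner_add_left)
  then have d: "d m \<le> 0" for m
    by (rule nonpos_form_imp_diagonal_nonpos [OF Q A_diag])
  note matfun_comp = transpose_matfun_component [OF Q A_diag]
  note mult_sum = linear_sum [OF matrix_vector_mul_linear]
  note A_comp = transpose_diagonalized_component [OF Q A_diag]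
  \<comment> \<open>\<open>on_reals\<close> keeps only the real part, so a nonzero complex value
    alone would not suffice; the coefficient is also real on the real axis.\<close>
  have nz: "\<alpha> (i + 1) i z \<noteq> 0" if "i \<in> {1..s}" "z \<le> 0" for i z
  proof -
    have "a (i + 1) i (of_real z) \<in> \<real>" "a (i + 1) i (of_real z) \<noteq> 0"
      using coeffs that by (auto simp: EERK_coeffs_def)
    then show ?thesis
      by (auto simp: \<alpha>_def on_reals_def elim!: Reals_cases)
  qed
  have stage: "(\<Sum>l=1..k. matfun (diffmat \<alpha> k l) A *v \<delta>U n l) =
      \<tau> *\<^sub>R (stab_g \<kappa> g (U n k) - stab_L \<kappa> L *v ((1 / 2) *\<^sub>R (U n k + U n (k + 1))))"
    if n: "n \<ge> 1" and k: "k \<in> {1..s}" for n k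
  proof (rule orthogonal_matrix_transpose_inject [OF Q], unfold vec_eq_iff, rule allI)
    fix m
    define w where "w i = (transpose Q *v U n i) $ m" for i
    define \<gamma> where "\<gamma> i = (transpose Q *v (\<tau> *\<^sub>R stab_g \<kappa> g (U n i))) $ m" for i
    have w: "w (i + 1) = w 1 + (\<Sum>j=1..i. \<alpha> (i + 1) j (d m) * (\<gamma> j + d m * w 1))"
      if i: "i \<in> {1..s}" for i
    proof -
      \<comment> \<open>Reading the linear term as \<open>A *v U n 1\<close> gives the shape
        \<open>\<gamma> j + z * w 1\<close> in each coordinate.\<close>
      have "U n (i + 1) = U n 1 +
          (\<Sum>j=1..i. matfun (\<alpha> (i + 1) j) A *v (\<tau> *\<^sub>R stab_g \<kappa> g (U n j) + A *v U n 1))"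
        using sol n i unfolding EERK_solution_def A_def [symmetric] by (simp add: Avec)
      then show ?thesis
        unfolding w_def \<gamma>_def
        by (simp add: matrix_vector_right_distrib mult_sum matfun_comp A_comp distrib_left
            del: transpose_matrix_vector)
    qed
    have "(transpose Q *v (\<Sum>l=1..k. matfun (diffmat \<alpha> k l) A *v \<delta>U n l)) $ m =
        (\<Sum>l=1..k. diffmat \<alpha> k l (d m) * (w (l + 1) - w l))"
      by (simp add: mult_sum matfun_comp \<delta>U_def w_def
          matrix_vector_mult_diff_distrib right_diff_distrib del: transpose_matrix_vector)
    also have "\<dots> = \<gamma> k + d m * ((w k + w (k + 1)) / 2)"
      using nz d w k by (intro diffmat_increments [of s]) auto
    also have "\<dots> = (transpose Q *v (\<tau> *\<^sub>R stab_g \<kappa> g (U n k) +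
        A *v ((1 / 2) *\<^sub>R (U n k + U n (k + 1))))) $ m"
      unfolding matrix_vector_right_distrib vector_add_component A_comp
      by (simp add: w_def \<gamma>_def matrix_vector_right_distrib matrix_vector_mult_scaleR
          del: transpose_matrix_vector)
    finally show "(transpose Q *v (\<Sum>l=1..k. matfun (diffmat \<alpha> k l) A *v \<delta>U n l)) $ m =
        (transpose Q *v (\<tau> *\<^sub>R (stab_g \<kappa> g (U n k) -
          stab_L \<kappa> L *v ((1 / 2) *\<^sub>R (U n k + U n (k + 1)))))) $ m"
      by (simp add: Avec scaleR_diff_right)
  qed
  \<comment> \<open>The factor \<open>1 / \<tau>\<close> cancels the \<open>\<tau>\<close> in
    \<open>stage\<close>, leaving the bound of \<open>energy_increment_le\<close>.\<close>
  have step: "energy L G (U n (k + 1)) - energy L G (U n k) \<le>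
      - (1 / \<tau>) * (\<delta>U n k \<bullet> (\<Sum>l=1..k. matfun (diffmat \<alpha> k l) A *v \<delta>U n l))"
    if "n \<ge> 1" "k \<in> {1..s}" for n k
    using energy_increment_le [OF LT G_grad g_Lipschitz(2) \<kappa>, of "U n (k + 1)" "U n k"] \<tau>
    unfolding stage [OF that] by (simp add: \<delta>U_def)
  have decay: "energy L G (U n (j + 1)) - energy L G (U n 1) \<le> R n j"
    if n: "n \<ge> 1" and j: "j \<in> {1..s}" for n j
  proof -
    have "energy L G (U n (j + 1)) - energy L G (U n 1) =
        (\<Sum>k=1..j. energy L G (U n (k + 1)) - energy L G (U n k))"
      using sum_Suc_diff [of 1 j "\<lambda>k. energy L G (U n k)"] by simp
    also have "\<dots> \<le> R n j"
      unfolding R_eq sum_distrib_left using n j by (intro sum_mono step) auto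
    finally show ?thesis .
  qed
  have nonpos: "R n j \<le> 0" if j: "j \<in> {1..s}" for n j
  proof -
    define x where "x m k = (transpose Q *v \<delta>U n k) $ m" for m k
    have inner: "v \<bullet> (matfun f A *v w) =
        (\<Sum>m\<in>UNIV. (transpose Q *v v) $ m * f (d m) * (transpose Q *v w) $ m)" for v w f
      using orthogonal_matrix_inner_transpose [OF Q, of v "matfun f A *v w"]
      unfolding inner_vec_def [of "transpose Q *v v"] matfun_comp by (simp only: inner_real_def mult.assoc)
    have "(\<Sum>k=1..j. \<delta>U n k \<bullet> (\<Sum>l=1..k. matfun (diffmat \<alpha> k l) A *v \<delta>U n l)) =
        (\<Sum>k=1..j. \<Sum>l=1..k. \<Sum>m\<in>UNIV. x m k * diffmat \<alpha> k l (d m) * x m l)"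
      by (simp only: inner_sum_right inner x_def)
    \<comment> \<open>With the eigenvalue index outermost, each summand is the form of the scalar
      matrix \<open>D\<close> at the single point \<open>d m\<close>.\<close>
    also have "\<dots> = (\<Sum>m\<in>UNIV. \<Sum>k=1..j. \<Sum>l=1..k. x m k * diffmat \<alpha> k l (d m) * x m l)"
      by (simp only: sum.swap [of _ UNIV])
    also have "\<dots> \<ge> 0"
      using D [OF d] j by (intro sum_nonneg sym_pos_semidef_lower_triangular [of s])
        (auto simp: diffmat_def)
    finally show ?thesis
      using \<tau> by (simp add: R_eq)
  qed
  have "energy L G (u n) - energy L G (u (n - 1)) \<le> R n s" if n: "n \<ge> 1" for n
    using decay [OF n, of s] s sol n by (simp add: EERK_solution_def)
  with decay nonpos show ?thesis by blast
qed

end
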